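(* Let $a\in\mathbb{R}$, $\mu\in\mathbb{R}\setminus\mathbb{N}^{-1}$ and $\nu\in\mathbb{R}\setminus\mathbb{N}^0$. Let $\Delta_{a+\mu}^{-\nu}[(s-a)^{\underline{\mu}}](t)$ denote the fractional sum-difference operator of order $\nu$ based at $a+\mu$, applied to the function $s\mapsto (s-a)^{\underline{\mu}}$ on $\mathbb{N}_{a+\mu}$ and evaluated at $t$. If $\mu+\nu\notin\mathbb{N}^{-1}$, then $$\Delta_{a+\mu}^{-\nu}[(s-a)^{\underline{\mu}}](t)=\frac{\Gamma(\mu+1)}{\Gamma(\mu+\nu+1)}(t-a)^{\underline{\mu+\nu}}\quad\text{for all } t\in\mathbb{N}_{a+\mu+\nu},$$ while, if $\mu+\nu\in\mathbb{N}^{-1}$, then $$\Delta_{a+\mu}^{-\nu}[(s-a)^{\underline{\mu}}](t)=0\quad\text{for all } t\in\mathbb{N}_{a}.$$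
   Context: For a real number $c$, $\mathbb{N}_c=\{c,c+1,c+2,\ldots\}$ and $\mathbb{N}^c=\{\ldots,c-2,c-1,c\}$; in particular $\mathbb{N}^{0}$ is the set of non-positive integers and $\mathbb{N}^{-1}$ the set of negative integers. Falling function: for $x,y\in\mathbb{R}$, $(x)^{\underline{y}}=x^{\underline{y}}$ equals $x(x-1)\cdots(x-y+1)$ if $y\in\mathbb{N}_1$; $1$ if $y=0$; $\frac{\Gamma(x+1)}{\Gamma(x+1-y)}$ if $x,\,x-y\notin\mathbb{N}^{-1}$; and $0$ if $x\notin\mathbb{N}^{-1}$ and $x-y\in\mathbb{N}^{-1}$. Fractional sum-difference operator (Miller--Ross): for $c\in\mathbb{R}$, $\nu\in\mathbb{R}\setminus\mathbb{N}^0$ and $f:\mathbb{N}_c\to\mathbb{R}$, $$\Delta_c^{-\nu}f(t)=\frac{1}{\Gamma(\nu)}\sum_{s=c}^{t-\nu}(t-(s+1))^{\underline{\nu-1}}f(s),\quad t\in\mathbb{N}_{c+\nu},$$ where $s$ runs over $c,c+1,\ldots,t-\nu$. *)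

theory Defs
  imports "HOL-Analysis.Gamma_Function"
begin

definition nats_from :: "real \<Rightarrow> real set" where
  "nats_from c = {c + real k | k. True}"

definition nats_upto :: "real \<Rightarrow> real set" where
  "nats_upto c = {c - real k | k. True}"

(* The clauses overlap, but they agree where they do. The falling function has no
   value when x is a negative integer and y is not a natural number. *)
definition falling :: "real \<Rightarrow> real \<Rightarrow> real" where
  "falling x y =
     (if y \<in> nats_from 1 then (\<Prod>i<nat \<lfloor>y\<rfloor>. x - real i)
      else if y = 0 then 1
      else if x \<notin> nats_upto (- 1) \<and> x - y \<notin> nats_upto (- 1)
        then Gamma (x + 1) / Gamma (x + 1 - y)
      else if x \<notin> nats_upto (- 1) \<and> x - y \<in> nats_upto (- 1) then 0
      else undefined)"

(* Miller--Ross operator of order \<nu> based at c; it has its mathematical meaning for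
   \<nu> \<notin> nats_upto 0 and t \<in> nats_from (c + \<nu>), and uses f only on nats_from c.
   The index set is {c, c + 1, ..., t - \<nu>}. *)
definition frac_sum :: "real \<Rightarrow> real \<Rightarrow> (real \<Rightarrow> real) \<Rightarrow> real \<Rightarrow> real" where
  "frac_sum c \<nu> f t =
     1 / Gamma \<nu> *
     (\<Sum>s\<in>{s \<in> nats_from c. s \<le> t - \<nu>}. falling (t - (s + 1)) (\<nu> - 1) * f s)"

end

theory Submission
  imports Defs
begin

text \<open>
  Every point at which the operator is evaluated has the form \<open>t = a + \<mu> + \<nu> + n\<close> with a natural
  number \<open>n\<close>, and the summation index is then \<open>s = a + \<mu> + k\<close> with \<open>k \<le> n\<close>. Both factors of a
  summand then have the form \<open>falling (x + i) x\<close> with a natural number \<open>i\<close>: one with \<open>x = \<nu> - 1\<close> and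
  \<open>i = n - k\<close>, the other with \<open>x = \<mu>\<close> and \<open>i = k\<close>. Such a value (lemma \<open>falling_add_nat\<close>) is
  \<open>Gamma (x + 1) * pochhammer (x + 1) i / fact i\<close>. Up to the factor
  \<open>Gamma (\<mu> + 1)\<close>, the fractional sum is therefore the coefficient of \<open>z ^ n\<close> in the product of
  the binomial series of \<open>(1 - z) powr - \<nu>\<close> and \<open>(1 - z) powr - (\<mu> + 1)\<close>. By the
  Chu--Vandermonde identity (lemma \<open>frac_sum_falling\<close>) it equals
  \<open>Gamma (\<mu> + 1) * pochhammer (\<mu> + \<nu> + 1) n / fact n\<close>.

  This closed form covers both parts. If \<open>\<mu> + \<nu>\<close> is not a negative integer, evaluating
  the falling function on the right-hand side in the same way gives this closed form again. If \<open>\<mu> + \<nu> = - m\<close> with \<open>m \<ge> 1\<close>, then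
  \<open>t = a + j\<close> corresponds to \<open>n = m + j\<close>, and \<open>pochhammer (1 - m) n\<close> vanishes because \<open>m - 1 < n\<close>.
\<close>

lemma nonpos_Int_add_one_iff:
  fixes x :: real
  shows "x + 1 \<in> \<int>\<^sub>\<le>\<^sub>0 \<longleftrightarrow> x \<in> nats_upto (- 1)"
proof
  assume "x + 1 \<in> \<int>\<^sub>\<le>\<^sub>0"
  then obtain k where "x + 1 = - real k"
    by (auto elim: nonpos_Ints_cases')
  then have "x = - 1 - real k" by simp
  then show "x \<in> nats_upto (- 1)" unfolding nats_upto_def by blast
qed (auto simp: nats_upto_def)

lemma prod_descending_eq_fact:
  "(\<Prod>i<p. real p + real k - real i) = fact (p + k) / fact k"
proof (induction p)
  case (Suc p)
  have "(\<Prod>i<Suc p. real (Suc p) + real k - real i)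
          = real (Suc (p + k)) * (\<Prod>i<p. real p + real k - real i)"
    by (simp only: prod.lessThan_Suc_shift) (simp add: diff_diff_eq add_ac)
  then show ?case using Suc by simp
qed simp

text \<open>
  The falling function is given by a product at positive integers \<open>x\<close>, by a constant at \<open>0\<close> and by a
  Gamma quotient at the remaining \<open>x\<close>. The three agree because \<open>x + k - x = k\<close> is a natural number:
  in each case the value is \<open>Gamma (x + k + 1) / Gamma (k + 1)\<close>.
\<close>

lemma falling_add_nat:
  assumes x: "x \<notin> nats_upto (- 1)"
  shows "falling (x + real k) x = Gamma (x + 1) * pochhammer (x + 1) k / fact k"
proof -
  have "x + 1 \<notin> \<int>\<^sub>\<le>\<^sub>0" using x by (simp add: nonpos_Int_add_one_iff)
  then have Gamma_shift: "Gamma (x + 1) * pochhammer (x + 1) k = Gamma (x + 1 + real k)"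
    by (simp add: pochhammer_Gamma Gamma_eq_zero_iff)
  consider (pos) "x \<in> nats_from 1" | (zero) "x = 0" | (other) "x \<notin> nats_from 1" "x \<noteq> 0"
    by blast
  then show ?thesis
  proof cases
    case pos
    then obtain j where "x = 1 + real j" by (auto simp: nats_from_def)
    then have p: "x = real (Suc j)" by simp
    have "falling (x + real k) x = (\<Prod>i<Suc j. real (Suc j) + real k - real i)"
      using pos unfolding falling_def p by (simp only: floor_of_nat nat_int if_True)
    also have "\<dots> = fact (Suc j + k) / fact k" by (rule prod_descending_eq_fact)
    also have "\<dots> = Gamma (x + 1 + real k) / fact k"
      using Gamma_fact[of "Suc j + k", where 'a = real] by (simp add: p algebra_simps)
    finally show ?thesis by (simp add: Gamma_shift)
  next
    case zero
    then show ?thesis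
      by (simp add: falling_def nats_from_def pochhammer_fact[symmetric])
  next
    case other
    have "x + real k \<notin> nats_upto (- 1)"
    proof
      assume "x + real k \<in> nats_upto (- 1)"
      then obtain j where "x + real k = - 1 - real j" by (auto simp: nats_upto_def)
      then have "x = - 1 - real (j + k)" by simp
      with x show False unfolding nats_upto_def by blast
    qed
    moreover have "real k \<notin> nats_upto (- 1)" by (auto simp: nats_upto_def)
    ultimately have "falling (x + real k) x = Gamma (x + 1 + real k) / Gamma (real k + 1)"
      using other by (simp add: falling_def algebra_simps)
    then show ?thesis
      unfolding Gamma_shift using Gamma_fact[of k, where 'a = real] by (simp add: add.commute)
  qed
qed

lemma summation_range:
  "{s \<in> nats_from c. s \<le> c + real n} = (\<lambda>k. c + real k) ` {..n}"
  by (auto simp: nats_from_def)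

text \<open>
  After the Gamma factors are pulled out, the summands are
  those of the Chu--Vandermonde identity for \<open>pochhammer ((\<mu> + 1) + \<nu>) n\<close>. Writing the result with
  a Pochhammer symbol instead of \<open>Gamma (\<mu> + \<nu> + 1 + n) / Gamma (\<mu> + \<nu> + 1)\<close> keeps it meaningful
  at the poles of the Gamma function, where \<open>\<mu> + \<nu>\<close> is a negative integer.
\<close>

lemma frac_sum_falling:
  assumes \<mu>: "\<mu> \<notin> nats_upto (- 1)" and \<nu>: "\<nu> \<notin> nats_upto 0"
  shows "frac_sum (a + \<mu>) \<nu> (\<lambda>s. falling (s - a) \<mu>) (a + \<mu> + \<nu> + real n) =
           Gamma (\<mu> + 1) * pochhammer (\<mu> + \<nu> + 1) n / fact n"
proof -
  have \<nu>1: "\<nu> - 1 \<notin> nats_upto (- 1)" using \<nu> by (auto simp: nats_upto_def)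
  then have "Gamma \<nu> \<noteq> 0"
    using nonpos_Int_add_one_iff[of "\<nu> - 1"] by (simp add: Gamma_eq_zero_iff)
  have summand:
    "falling (a + \<mu> + \<nu> + real n - ((a + \<mu> + real k) + 1)) (\<nu> - 1) * falling (a + \<mu> + real k - a) \<mu>
       = Gamma \<nu> * Gamma (\<mu> + 1) / fact n *
         (of_nat (n choose k) * pochhammer (\<mu> + 1) k * pochhammer \<nu> (n - k))"
    if "k \<le> n" for k
  proof -
    have "a + \<mu> + \<nu> + real n - ((a + \<mu> + real k) + 1) = (\<nu> - 1) + real (n - k)"
      using that by (simp add: of_nat_diff)
    moreover have "a + \<mu> + real k - a = \<mu> + real k" by simp
    ultimately show ?thesis
      using that
      by (simp only: falling_add_nat[OF \<nu>1] falling_add_nat[OF \<mu>] binomial_fact)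
         (simp add: field_simps)
  qed
  have "frac_sum (a + \<mu>) \<nu> (\<lambda>s. falling (s - a) \<mu>) (a + \<mu> + \<nu> + real n) =
      1 / Gamma \<nu> * (\<Sum>k\<le>n. falling (a + \<mu> + \<nu> + real n - ((a + \<mu> + real k) + 1)) (\<nu> - 1)
                                * falling (a + \<mu> + real k - a) \<mu>)"
    using summation_range[of "a + \<mu>" n]
    by (simp add: frac_sum_def sum.reindex inj_on_def algebra_simps)
  also have "\<dots> = 1 / Gamma \<nu> * (Gamma \<nu> * Gamma (\<mu> + 1) / fact n *
      (\<Sum>k\<le>n. of_nat (n choose k) * pochhammer (\<mu> + 1) k * pochhammer \<nu> (n - k)))"
    unfolding sum_distrib_left[of "Gamma \<nu> * Gamma (\<mu> + 1) / fact n"]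
    by (intro arg_cong[where f = "\<lambda>x. 1 / Gamma \<nu> * x"] sum.cong refl summand) simp
  also have "\<dots> = Gamma (\<mu> + 1) * pochhammer (\<mu> + \<nu> + 1) n / fact n"
    unfolding pochhammer_binomial_sum[symmetric]
    using \<open>Gamma \<nu> \<noteq> 0\<close> by (simp add: add_ac)
  finally show ?thesis .
qed

theorem corollary3p4:
  fixes a \<mu> \<nu> :: real
  assumes "\<mu> \<notin> nats_upto (- 1)"
    and "\<nu> \<notin> nats_upto 0"
  shows "(\<mu> + \<nu> \<notin> nats_upto (- 1) \<longrightarrow>
            (\<forall>t\<in>nats_from (a + \<mu> + \<nu>).
               frac_sum (a + \<mu>) \<nu> (\<lambda>s. falling (s - a) \<mu>) t =
                 Gamma (\<mu> + 1) / Gamma (\<mu> + \<nu> + 1) * falling (t - a) (\<mu> + \<nu>))) \<and>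
         (\<mu> + \<nu> \<in> nats_upto (- 1) \<longrightarrow>
            (\<forall>t\<in>nats_from a.
               frac_sum (a + \<mu>) \<nu> (\<lambda>s. falling (s - a) \<mu>) t = 0))"
proof (intro conjI impI ballI)
  fix t assume regular: "\<mu> + \<nu> \<notin> nats_upto (- 1)" and "t \<in> nats_from (a + \<mu> + \<nu>)"
  then obtain n where t: "t = a + \<mu> + \<nu> + real n" by (auto simp: nats_from_def)
  have "t - a = (\<mu> + \<nu>) + real n" by (simp add: t)
  then have "falling (t - a) (\<mu> + \<nu>)
               = Gamma (\<mu> + \<nu> + 1) * pochhammer (\<mu> + \<nu> + 1) n / fact n"
    using falling_add_nat[OF regular] by simp
  moreover have "Gamma (\<mu> + \<nu> + 1) \<noteq> 0"
    using regular by (simp add: Gamma_eq_zero_iff nonpos_Int_add_one_iff)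
  ultimately show "frac_sum (a + \<mu>) \<nu> (\<lambda>s. falling (s - a) \<mu>) t =
      Gamma (\<mu> + 1) / Gamma (\<mu> + \<nu> + 1) * falling (t - a) (\<mu> + \<nu>)"
    by (simp add: t frac_sum_falling[OF assms])
next
  fix t assume "\<mu> + \<nu> \<in> nats_upto (- 1)" and "t \<in> nats_from a"
  then obtain i j where i: "\<mu> + \<nu> = - 1 - real i" and j: "t = a + real j"
    by (auto simp: nats_upto_def nats_from_def)
  have "t = a + \<mu> + \<nu> + real (Suc i + j)" using i j by simp
  moreover have "pochhammer (\<mu> + \<nu> + 1) (Suc i + j) = 0"
    using i by (simp add: pochhammer_of_nat_eq_0_lemma)
  ultimately show "frac_sum (a + \<mu>) \<nu> (\<lambda>s. falling (s - a) \<mu>) t = 0"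
    using frac_sum_falling[OF assms, of a "Suc i + j"] by simp
qed

end
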